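(* Let $G$ be a finite group and $\rho: G \to \mathrm{GL}_{n_3}(\mathbb{C})$ a representation. Suppose that the decomposition of $\mathbb{C}^{n_3}$ into irreducible representations is $\mathbb{C}^{n_3} \simeq V_1 \oplus V_2 \oplus \cdots \oplus V_m$, where $\dim_{\mathbb{C}}(V_j) = d_j$ for $j \in \{1,\dots,m\}$. Let $M \in \mathrm{GL}_{n_3}(\mathbb{C})$ represent a change of basis to a symmetry-adapted basis. Then there is a vector subspace $W_\rho \subseteq \mathbb{C}_M$ such that the multiplication map $T_{\mathbf{a}}$ is $\rho$-equivariant if and only if $\mathbf{a} \in W_\rho$, and $W_\rho$ is given explicitly by $$W_\rho = \left\{ \mathbf{x} \in \mathbb{C}^{1\times 1\times n_3} \;\middle|\; \mathrm{diag}(M\,\mathrm{vec}(\mathbf{x})) = \begin{bmatrix} c_1 I_{d_1} & & & \\ & c_2 I_{d_2} & & \\ & & \ddots & \\ & & & c_m I_{d_m}\end{bmatrix},\ c_1,\dots,c_m \in \mathbb{C}\right\}.$$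
   Context: A tube is an element $\mathbf{a} \in \mathbb{C}^{1\times 1\times n_3}$; $\mathrm{vec}(\mathbf{a}) \in \mathbb{C}^{n_3}$ is the column vector with entries $\mathrm{vec}(\mathbf{a})_k = \mathbf{a}_{1,1,k}$, and $\mathrm{tube}$ is the inverse of $\mathrm{vec}$. For a vector $v$, $\mathrm{diag}(v)$ is the diagonal matrix with the entries of $v$ on the diagonal. For $M \in \mathrm{GL}_{n_3}(\mathbb{C})$, the $\star_M$-product of tubes is $\mathbf{a} \star_M \mathbf{b} = \mathrm{tube}(M^{-1}\mathrm{diag}(M\mathrm{vec}(\mathbf{a}))M\mathrm{vec}(\mathbf{b}))$, and $\mathbb{C}_M$ denotes the ring of tubes $\mathbb{C}^{1\times1\times n_3}$ with multiplication $\star_M$. The multiplication map is $T_{\mathbf{a}}: \mathbb{C}_M \to \mathbb{C}_M$, $T_{\mathbf{a}}(\mathbf{x}) = \mathbf{a} \star_M \mathbf{x}$. The group $G$ acts on tubes by $g\cdot \mathbf{x} = \mathrm{tube}(\rho(g)\mathrm{vec}(\mathbf{x}))$, and $T_{\mathbf{a}}$ is $\rho$-equivariant if $T_{\mathbf{a}}(g\cdot\mathbf{x}) = g\cdot T_{\mathbf{a}}(\mathbf{x})$ for all $g \in G$ and all tubes $\mathbf{x}$. Symmetry-adapted basis: for a representation $V = V_1\oplus\cdots\oplus V_m$ decomposed into irreducibles with $\dim V_i = d_i$, an ordered basis $\{v^{(1)}_1,\dots,v^{(1)}_{d_1}\}\cup\cdots\cup\{v^{(m)}_1,\dots,v^{(m)}_{d_m}\}$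 of $V$ is symmetry-adapted if (1) $\{v^{(i)}_1,\dots,v^{(i)}_{d_i}\}$ is a basis of $V_i$ for each $i$; and (2) whenever $T: V\to V$ is a $\rho$-equivariant linear map (i.e. $T\rho(g) = \rho(g)T$ for all $g$), its matrix with respect to this basis has blocks $T_{i,j}: V_i \to V_j$ with $T_{i,j} = c_{i,j}I$ for a scalar $c_{i,j}$ or $T_{i,j}=0$. "$M$ represents a change of basis to a symmetry-adapted basis" means that $M$ sends standard coordinates to coordinates in the symmetry-adapted basis: the columns of $M^{-1}$, in order, are the vectors of the symmetry-adapted basis, so $M\rho(g)M^{-1}$ is block diagonal with irreducible blocks of sizes $d_1,\dots,d_m$ in this order. *)

theory Defs
  imports "Jordan_Normal_Form.VS_Connect"
begin

section \<open>Complex vectors and the general linear group\<close>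

text \<open>All indices run from \<open>0\<close>: entries over \<open>{0..<n}\<close>, summands over \<open>{0..<m}\<close>.\<close>

abbreviation cvec :: "nat \<Rightarrow> (complex, complex vec) module" where
  "cvec n \<equiv> module_vec TYPE(complex) n"

abbreviation subspc :: "(complex, 'v, 'b) module_scheme \<Rightarrow> 'v set \<Rightarrow> bool" where
  "subspc V W \<equiv> VectorSpace.subspace (class_ring :: complex ring) W V"

definition GL :: "nat \<Rightarrow> complex mat monoid" where
  "GL n = units_of (ring_mat TYPE(complex) n ())"

definition diag :: "complex vec \<Rightarrow> complex mat" where
  "diag v = mat_diag (dim_vec v) (\<lambda>i. v $ i)"

section \<open>Tubes\<close>

text \<open>A third-order tensor is a function of three indices; an element of
  \<open>\<complex>\<close>-tensors of size \<open>1 \<times> 1 \<times> n\<close> is represented by the function extended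
  by zero outside the index range, so that equality of tubes is equality of functions.\<close>

type_synonym tensor3 = "nat \<Rightarrow> nat \<Rightarrow> nat \<Rightarrow> complex"

definition tubes :: "nat \<Rightarrow> tensor3 set" where
  "tubes n = {a. \<forall>i j k. \<not> (i < 1 \<and> j < 1 \<and> k < n) \<longrightarrow> a i j k = 0}"

definition vec_of_tube :: "nat \<Rightarrow> tensor3 \<Rightarrow> complex vec" where
  "vec_of_tube n a = Matrix.vec n (\<lambda>k. a 0 0 k)"

definition tube_of_vec :: "complex vec \<Rightarrow> tensor3" where
  "tube_of_vec v = (\<lambda>i j k. if i < 1 \<and> j < 1 \<and> k < dim_vec v then v $ k else 0)"

definition star :: "nat \<Rightarrow> complex mat \<Rightarrow> tensor3 \<Rightarrow> tensor3 \<Rightarrow> tensor3" where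
  "star n M a b = tube_of_vec
     ((inv\<^bsub>GL n\<^esub> M * diag (M *\<^sub>v vec_of_tube n a) * M) *\<^sub>v vec_of_tube n b)"

text \<open>The ring \<open>\<complex>\<^sub>M\<close> together with its scalar multiplication, so that it is also a
  complex vector space. The unit is the tube whose image under \<open>M\<close> is the all-ones vector.\<close>

definition tube_ring :: "nat \<Rightarrow> complex mat \<Rightarrow> (complex, tensor3) module" where
  "tube_ring n M =
     \<lparr>carrier = tubes n,
      monoid.mult = star n M,
      one = tube_of_vec (inv\<^bsub>GL n\<^esub> M *\<^sub>v Matrix.vec n (\<lambda>_. 1)),
      zero = (\<lambda>i j k. 0),
      add = (\<lambda>a b i j k. a i j k + b i j k),
      module.smult = (\<lambda>c a i j k. c * a i j k)\<rparr>"

definition mult_map :: "nat \<Rightarrow> complex mat \<Rightarrow> tensor3 \<Rightarrow> tensor3 \<Rightarrow> tensor3" where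
  "mult_map n M a = (\<lambda>x. a \<otimes>\<^bsub>tube_ring n M\<^esub> x)"

section \<open>Representations\<close>

definition is_representation :: "('g, 'b) monoid_scheme \<Rightarrow> nat \<Rightarrow> ('g \<Rightarrow> complex mat) \<Rightarrow> bool" where
  "is_representation G n \<rho> \<longleftrightarrow> \<rho> \<in> hom G (GL n)"

definition tube_action :: "nat \<Rightarrow> ('g \<Rightarrow> complex mat) \<Rightarrow> 'g \<Rightarrow> tensor3 \<Rightarrow> tensor3" where
  "tube_action n \<rho> g x = tube_of_vec (\<rho> g *\<^sub>v vec_of_tube n x)"

definition tube_equivariant ::
  "('g, 'b) monoid_scheme \<Rightarrow> nat \<Rightarrow> ('g \<Rightarrow> complex mat) \<Rightarrow> (tensor3 \<Rightarrow> tensor3) \<Rightarrow> bool" where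
  "tube_equivariant G n \<rho> T \<longleftrightarrow>
     (\<forall>g\<in>carrier G. \<forall>x\<in>tubes n. T (tube_action n \<rho> g x) = tube_action n \<rho> g (T x))"

definition equivariant_linear ::
  "('g, 'b) monoid_scheme \<Rightarrow> nat \<Rightarrow> ('g \<Rightarrow> complex mat) \<Rightarrow> (complex vec \<Rightarrow> complex vec) \<Rightarrow> bool" where
  "equivariant_linear G n \<rho> T \<longleftrightarrow>
     linear_map (class_ring :: complex ring) (cvec n) (cvec n) T \<and>
     (\<forall>g\<in>carrier G. \<forall>v\<in>carrier_vec n. T (\<rho> g *\<^sub>v v) = \<rho> g *\<^sub>v T v)"

definition subrep ::
  "('g, 'b) monoid_scheme \<Rightarrow> nat \<Rightarrow> ('g \<Rightarrow> complex mat) \<Rightarrow> complex vec set \<Rightarrow> bool" where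
  "subrep G n \<rho> W \<longleftrightarrow>
     subspc (cvec n) W \<and> (\<forall>g\<in>carrier G. \<forall>w\<in>W. \<rho> g *\<^sub>v w \<in> W)"

definition irreducible_subrep ::
  "('g, 'b) monoid_scheme \<Rightarrow> nat \<Rightarrow> ('g \<Rightarrow> complex mat) \<Rightarrow> complex vec set \<Rightarrow> bool" where
  "irreducible_subrep G n \<rho> W \<longleftrightarrow>
     subrep G n \<rho> W \<and> W \<noteq> {0\<^sub>v n} \<and>
     (\<forall>U. subrep G n \<rho> U \<and> U \<subseteq> W \<longrightarrow> U = {0\<^sub>v n} \<or> U = W)"

definition is_direct_sum :: "nat \<Rightarrow> nat \<Rightarrow> (nat \<Rightarrow> complex vec set) \<Rightarrow> bool" where
  "is_direct_sum n m V \<longleftrightarrow>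
     (\<forall>i<m. subspc (cvec n) (V i)) \<and>
     (\<forall>v\<in>carrier_vec n. \<exists>!u. u \<in> (\<Pi>\<^sub>E i\<in>{..<m}. V i) \<and> v = finsum (cvec n) u {..<m})"

definition irreducible_decomposition ::
  "('g, 'b) monoid_scheme \<Rightarrow> nat \<Rightarrow> ('g \<Rightarrow> complex mat) \<Rightarrow> nat \<Rightarrow>
     (nat \<Rightarrow> complex vec set) \<Rightarrow> bool" where
  "irreducible_decomposition G n \<rho> m V \<longleftrightarrow>
     is_direct_sum n m V \<and> (\<forall>i<m. irreducible_subrep G n \<rho> (V i))"

definition subspace_dim :: "nat \<Rightarrow> complex vec set \<Rightarrow> nat" where
  "subspace_dim n W = vectorspace.dim (class_ring :: complex ring) (cvec n\<lparr>carrier := W\<rparr>)"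

section \<open>Symmetry-adapted bases\<close>

definition ordered_basis :: "nat \<Rightarrow> complex vec set \<Rightarrow> complex vec list \<Rightarrow> bool" where
  "ordered_basis n W vs \<longleftrightarrow>
     distinct vs \<and>
     vectorspace.basis (class_ring :: complex ring) (cvec n\<lparr>carrier := W\<rparr>) (set vs)"

definition coordinates :: "nat \<Rightarrow> complex vec list \<Rightarrow> complex vec \<Rightarrow> complex vec" where
  "coordinates n vs v =
     (THE x. x \<in> carrier_vec (length vs) \<and> mat_of_cols n vs *\<^sub>v x = v)"

definition matrix_of :: "nat \<Rightarrow> complex vec list \<Rightarrow> (complex vec \<Rightarrow> complex vec) \<Rightarrow> complex mat" where
  "matrix_of n vs T = mat_of_cols (length vs) (map (\<lambda>v. coordinates n vs (T v)) vs)"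

text \<open>For blocks of sizes \<open>d 0, d 1, \<dots>\<close> the block \<open>T\<^sub>i\<^sub>j : V\<^sub>i \<rightarrow> V\<^sub>j\<close> consists
  of the columns belonging to \<open>V\<^sub>i\<close> and the rows belonging to \<open>V\<^sub>j\<close>.\<close>

definition matrix_block :: "(nat \<Rightarrow> nat) \<Rightarrow> complex mat \<Rightarrow> nat \<Rightarrow> nat \<Rightarrow> complex mat" where
  "matrix_block d A i j =
     Matrix.mat (d j) (d i) (\<lambda>(r, c). A $$ ((\<Sum>k<j. d k) + r, (\<Sum>k<i. d k) + c))"

text \<open>\<open>b i\<close> lists the basis vectors of \<open>V i\<close>. The equation with a multiple of the
  identity can only hold between spaces of equal dimension, as matrix equality includes
  the dimensions.\<close>

definition symmetry_adapted ::
  "('g, 'b) monoid_scheme \<Rightarrow> nat \<Rightarrow> ('g \<Rightarrow> complex mat) \<Rightarrow> nat \<Rightarrow>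
     (nat \<Rightarrow> complex vec set) \<Rightarrow> (nat \<Rightarrow> complex vec list) \<Rightarrow> bool" where
  "symmetry_adapted G n \<rho> m V b \<longleftrightarrow>
     (let vs = concat (map b [0..<m]); d = (\<lambda>i. length (b i)) in
       ordered_basis n (carrier_vec n) vs \<and>
       (\<forall>i<m. ordered_basis n (V i) (b i)) \<and>
       (\<forall>T. equivariant_linear G n \<rho> T \<longrightarrow>
         (\<forall>i<m. \<forall>j<m.
            (\<exists>c. matrix_block d (matrix_of n vs T) i j = c \<cdot>\<^sub>m 1\<^sub>m (d i)) \<or>
            matrix_block d (matrix_of n vs T) i j = 0\<^sub>m (d j) (d i))))"

definition change_of_basis :: "nat \<Rightarrow> complex mat \<Rightarrow> complex vec list \<Rightarrow> bool" where
  "change_of_basis n M vs \<longleftrightarrow> M \<in> carrier (GL n) \<and> cols (inv\<^bsub>GL n\<^esub> M) = vs"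

end

theory Submission
  imports Defs
begin

text \<open>In the symmetry-adapted basis \<open>T\<^sub>a\<close> has the matrix \<open>diag (M vec a)\<close>. If \<open>T\<^sub>a\<close> is
  equivariant, its diagonal blocks are scalar, so \<open>M vec a\<close> is constant on each block.
  Conversely, if it is constant on the blocks, then each \<open>V\<^sub>i\<close> lies in an eigenspace of
  \<open>T\<^sub>a\<close>, and as \<open>V\<^sub>i\<close> is invariant, \<open>T\<^sub>a\<close> commutes with the representation
  on every basis vector.\<close>

section \<open>Positions inside a concatenation of blocks\<close>

text \<open>Serves twice: to find the basis vector standing in a given column of the inverse of
  \<open>M\<close>, and to read off the diagonal of a matrix with scalar blocks.\<close>

lemma nth_concat_map_upt:
  assumes "i < m" and "r < length (f i)"
  shows "concat (map f [0..<m]) ! ((\<Sum>k<i. length (f k)) + r) = f i ! r"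
  using assms(1)
proof (induction m)
  case (Suc m)
  have len: "length (concat (map f [0..<j])) = (\<Sum>k<j. length (f k))" for j
    by (induction j) auto
  show ?case
  proof (cases "i = m")
    case True
    then show ?thesis using assms(2) by (simp add: nth_append len)
  next
    case False
    \<comment> \<open>Summing up to \<open>Suc i\<close> includes block \<open>i\<close> itself, so
      every position in it comes strictly before the last list.\<close>
    then have "(\<Sum>k<Suc i. length (f k)) \<le> (\<Sum>k<m. length (f k))"
      using Suc.prems by (intro sum_mono2) auto
    then have "(\<Sum>k<i. length (f k)) + r < (\<Sum>k<m. length (f k))"
      using assms(2) by simp
    then show ?thesis using Suc False by (simp add: nth_append len)
  qed
qed simp

lemma block_index_less:
  fixes d :: "nat \<Rightarrow> nat"
  assumes "i < m" and "r < d i"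
  shows "(\<Sum>k<i. d k) + r < (\<Sum>k<m. d k)"
proof -
  have "(\<Sum>k<Suc i. d k) \<le> (\<Sum>k<m. d k)"
    using assms(1) by (intro sum_mono2) auto
  then show ?thesis using assms(2) by simp
qed

text \<open>Peeling off the last block: an index either falls into it or is covered by the earlier
  blocks. This turns claims about all columns into claims about one block at a time.\<close>

lemma block_index_cases:
  fixes d :: "nat \<Rightarrow> nat"
  assumes "k < (\<Sum>i<m. d i)"
  obtains i r where "i < m" "r < d i" "k = (\<Sum>j<i. d j) + r"
  using assms
proof (induction m arbitrary: thesis)
  case (Suc m)
  show ?case
  proof (cases "k < (\<Sum>i<m. d i)")
    case True
    then show ?thesis using Suc.IH Suc.prems(1) less_Suc_eq by metis
  next
    case False
    then show ?thesis using Suc.prems by (intro Suc.prems(1)[of m "k - (\<Sum>i<m. d i)"]) auto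
  qed
qed simp

section \<open>Diagonal matrices with scalar blocks\<close>

lemma diag_carrier: "v \<in> carrier_vec n \<Longrightarrow> diag v \<in> carrier_mat n n"
  unfolding diag_def by auto

lemma diag_inject: "diag u = diag v \<longleftrightarrow> u = v"
proof
  assume eq: "diag u = diag v"
  have "dim_row (diag w) = dim_vec w" for w
    by (simp add: diag_def mat_diag_def)
  then have dim: "dim_vec u = dim_vec v" using eq by metis
  show "u = v"
  proof (rule eq_vecI)
    fix i assume i: "i < dim_vec v"
    have "diag w $$ (i, i) = w $ i" if "i < dim_vec w" for w
      using that by (simp add: diag_def mat_diag_def)
    then show "u $ i = v $ i" using eq dim i by metis
  qed (rule dim)
qed simp

text \<open>Rewriting the block matrix as a \<open>diag\<close> lets \<open>diag_inject\<close>
  reduce matrix equations to vector equations. The list \<open>js\<close> is arbitrary so that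
  induction can split off its first block.\<close>

lemma diag_block_mat_scalar_blocks:
  "diag_block_mat (map (\<lambda>j. c j \<cdot>\<^sub>m 1\<^sub>m (d j)) js) =
   diag (vec_of_list (concat (map (\<lambda>j. replicate (d j) (c j)) js)))"
proof (induction js)
  case Nil
  show ?case by (rule eq_matI) (auto simp: diag_def mat_diag_def)
next
  case (Cons j js)
  show ?case
    by (rule eq_matI)
      (auto simp: Cons.IH Let_def diag_def mat_diag_def vec_of_list_index nth_append)
qed

text \<open>Both matrices are diagonal, so only the two diagonals need comparing, block by block.
  This is the entrywise form in which membership in the subspace is handled later.\<close>

lemma diag_eq_scalar_blocks_iff:
  fixes d :: "nat \<Rightarrow> nat"
  assumes "dim_vec v = (\<Sum>i<m. d i)"
  shows "diag v = diag_block_mat (map (\<lambda>j. c j \<cdot>\<^sub>m 1\<^sub>m (d j)) [0..<m]) \<longleftrightarrow>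
    (\<forall>i<m. \<forall>r<d i. v $ ((\<Sum>k<i. d k) + r) = c i)" (is "?L \<longleftrightarrow> ?R")
proof -
  define u where "u = vec_of_list (concat (map (\<lambda>j. replicate (d j) (c j)) [0..<m]))"
  have dim: "dim_vec u = (\<Sum>i<m. d i)"
    unfolding u_def by (induction m) auto
  have u: "u $ ((\<Sum>k<i. d k) + r) = c i" if "i < m" "r < d i" for i r
    using nth_concat_map_upt[of i m r "\<lambda>j. replicate (d j) (c j)"] that
    by (simp add: u_def vec_of_list_index)
  have "?L \<longleftrightarrow> v = u"
    by (simp add: diag_block_mat_scalar_blocks diag_inject u_def)
  also have "\<dots> \<longleftrightarrow> ?R"
  proof
    assume R: ?R
    show "v = u"
    proof (rule eq_vecI)
      fix k assume "k < dim_vec u"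
      then obtain i r where "i < m" "r < d i" "k = (\<Sum>j<i. d j) + r"
        unfolding dim by (rule block_index_cases)
      then show "v $ k = u $ k" using R u by simp
    qed (use assms dim in simp)
  qed (use u in simp)
  finally show ?thesis .
qed

section \<open>Tubes, invertible matrices and the underlying vector spaces\<close>

lemma vec_of_tube_carrier: "vec_of_tube n x \<in> carrier_vec n"
  by (simp add: vec_of_tube_def)

lemma tube_of_vec_in_tubes: "v \<in> carrier_vec n \<Longrightarrow> tube_of_vec v \<in> tubes n"
  by (auto simp: tubes_def tube_of_vec_def)

lemma vec_of_tube_of_vec: "v \<in> carrier_vec n \<Longrightarrow> vec_of_tube n (tube_of_vec v) = v"
  by (auto simp: vec_of_tube_def tube_of_vec_def)

lemma GL_carrierD:
  assumes "M \<in> carrier (GL n)"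
  shows "M \<in> carrier_mat n n" "inv\<^bsub>GL n\<^esub> M \<in> carrier_mat n n"
    "M * inv\<^bsub>GL n\<^esub> M = 1\<^sub>m n" "inv\<^bsub>GL n\<^esub> M * M = 1\<^sub>m n"
proof -
  interpret R: ring "ring_mat TYPE(complex) n ()" by (rule ring_mat)
  have M: "M \<in> Units (ring_mat TYPE(complex) n ())"
    using assms by (simp add: GL_def units_of_carrier)
  \<comment> \<open>The inverse in the group of units is the inverse in the matrix ring, where the
    laws for units yield all four claims.\<close>
  then have eq: "inv\<^bsub>GL n\<^esub> M = inv\<^bsub>ring_mat TYPE(complex) n ()\<^esub> M"
    unfolding GL_def by (rule R.units_of_inv)
  show "M \<in> carrier_mat n n" "inv\<^bsub>GL n\<^esub> M \<in> carrier_mat n n"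
    "M * inv\<^bsub>GL n\<^esub> M = 1\<^sub>m n" "inv\<^bsub>GL n\<^esub> M * M = 1\<^sub>m n"
    using R.Units_closed[OF M] R.Units_inv_closed[OF M] R.Units_r_inv[OF M] R.Units_l_inv[OF M]
    unfolding eq by (simp_all add: ring_mat_simps)
qed

lemma vectorspace_cvec: "vectorspace (class_ring :: complex ring) (cvec n)"
proof -
  interpret vec_space "TYPE(complex)" n .
  show ?thesis by unfold_locales
qed

text \<open>Addition and scaling are pointwise, so the axioms reduce to identities between complex
  numbers.\<close>

lemma vectorspace_tube_ring: "vectorspace (class_ring :: complex ring) (tube_ring n M)"
proof -
  have "abelian_group (tube_ring n M)"
  proof (rule abelian_groupI)
    fix x assume "x \<in> carrier (tube_ring n M)"
    then show "\<exists>y\<in>carrier (tube_ring n M). y \<oplus>\<^bsub>tube_ring n M\<^esub> x = \<zero>\<^bsub>tube_ring n M\<^esub>"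
      by (intro bexI[of _ "\<lambda>i j k. - x i j k"]) (auto simp: tube_ring_def tubes_def)
  qed (auto simp: tube_ring_def tubes_def algebra_simps)
  moreover have "module_axioms (class_ring :: complex ring) (tube_ring n M)"
    by (auto simp: module_axioms_def tube_ring_def tubes_def algebra_simps)
  ultimately show ?thesis
    using class_field fieldE(1) by (auto simp: vectorspace_def Module.module_def)
qed

section \<open>From multiplication maps to matrices\<close>

lemma equivariant_linear_mat_iff:
  assumes A: "A \<in> carrier_mat n n"
  shows "equivariant_linear G n \<rho> ((*\<^sub>v) A) \<longleftrightarrow>
    (\<forall>g\<in>carrier G. \<forall>v\<in>carrier_vec n. A *\<^sub>v (\<rho> g *\<^sub>v v) = \<rho> g *\<^sub>v (A *\<^sub>v v))"
proof -
  have "(*\<^sub>v) A \<in> LinearCombinations.module_hom (class_ring :: complex ring) (cvec n) (cvec n)"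
    using A by (auto simp: LinearCombinations.module_hom_def module_vec_simps mult_add_distrib_mat_vec mult_mat_vec)
  then have "linear_map (class_ring :: complex ring) (cvec n) (cvec n) ((*\<^sub>v) A)"
    using vectorspace_cvec[of n]
    by (simp add: linear_map_def mod_hom_def mod_hom_axioms_def vectorspace_def)
  then show ?thesis by (simp add: equivariant_linear_def)
qed

text \<open>The matrix on the right is that of the multiplication map in standard coordinates;
  \<open>vec_of_tube\<close> and \<open>tube_of_vec\<close> carry the commutation law from tubes to
  vectors and back.\<close>

lemma tube_equivariant_mult_map_iff:
  assumes M: "M \<in> carrier (GL n)" and rep: "is_representation G n \<rho>"
  shows "tube_equivariant G n \<rho> (mult_map n M a) \<longleftrightarrow>
    equivariant_linear G n \<rho> ((*\<^sub>v) (inv\<^bsub>GL n\<^esub> M * diag (M *\<^sub>v vec_of_tube n a) * M))"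
    (is "_ \<longleftrightarrow> equivariant_linear G n \<rho> ((*\<^sub>v) ?A)")
proof -
  note GL = GL_carrierD[OF M]
  have "diag (M *\<^sub>v vec_of_tube n a) \<in> carrier_mat n n"
    using GL(1) vec_of_tube_carrier by (intro diag_carrier) auto
  then have A: "?A \<in> carrier_mat n n" using GL by simp
  have A_closed: "?A *\<^sub>v v \<in> carrier_vec n" if "v \<in> carrier_vec n" for v
    using A that by (rule mult_mat_vec_carrier)
  have rho: "\<rho> g *\<^sub>v v \<in> carrier_vec n" if "g \<in> carrier G" "v \<in> carrier_vec n" for g v
    using rep that GL_carrierD(1) unfolding is_representation_def
    by (metis hom_in_carrier mult_mat_vec_carrier)
  have T: "mult_map n M a x = tube_of_vec (?A *\<^sub>v vec_of_tube n x)" for x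
    by (simp add: mult_map_def tube_ring_def star_def)
  have "tube_equivariant G n \<rho> (mult_map n M a) \<longleftrightarrow>
    (\<forall>g\<in>carrier G. \<forall>v\<in>carrier_vec n. ?A *\<^sub>v (\<rho> g *\<^sub>v v) = \<rho> g *\<^sub>v (?A *\<^sub>v v))"
    (is "?L \<longleftrightarrow> ?R")
  proof
    assume L: ?L
    show ?R
    proof (intro ballI)
      fix g and v :: "complex vec" assume g: "g \<in> carrier G" and v: "v \<in> carrier_vec n"
      have "tube_of_vec (?A *\<^sub>v (\<rho> g *\<^sub>v v)) = tube_of_vec (\<rho> g *\<^sub>v (?A *\<^sub>v v))"
        using L[unfolded tube_equivariant_def T tube_action_def, rule_format,
            OF g tube_of_vec_in_tubes[OF v]]
        by (simp only: vec_of_tube_of_vec v rho g A_closed)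
      \<comment> \<open>On vectors of length \<open>n\<close>, \<open>tube_of_vec\<close> has the
        left inverse \<open>vec_of_tube n\<close> and can therefore be cancelled.\<close>
      then have "vec_of_tube n (tube_of_vec (?A *\<^sub>v (\<rho> g *\<^sub>v v))) =
          vec_of_tube n (tube_of_vec (\<rho> g *\<^sub>v (?A *\<^sub>v v)))"
        by (rule arg_cong)
      then show "?A *\<^sub>v (\<rho> g *\<^sub>v v) = \<rho> g *\<^sub>v (?A *\<^sub>v v)"
        by (simp only: vec_of_tube_of_vec v rho g A_closed)
    qed
  next
    assume R: ?R
    show ?L
      unfolding tube_equivariant_def T tube_action_def
      by (simp only: vec_of_tube_of_vec vec_of_tube_carrier rho A_closed R cong: ball_cong) simp
  qed
  then show ?thesis by (simp only: equivariant_linear_mat_iff[OF A])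
qed

section \<open>Matrices with respect to the columns of the inverse of \<open>M\<close>\<close>

text \<open>With the basis vectors as columns of the inverse, the coordinates solve a linear system
  whose unique solution is obtained by applying \<open>M\<close>.\<close>

lemma coordinates_cols_inverse:
  assumes M: "M \<in> carrier (GL n)" and v: "v \<in> carrier_vec n"
  shows "coordinates n (cols (inv\<^bsub>GL n\<^esub> M)) v = M *\<^sub>v v"
proof -
  note GL = GL_carrierD[OF M]
  have "mat_of_cols n (cols (inv\<^bsub>GL n\<^esub> M)) = inv\<^bsub>GL n\<^esub> M"
    using GL(2) by (metis carrier_matD(1) mat_of_cols_cols)
  moreover have "length (cols (inv\<^bsub>GL n\<^esub> M)) = n" using GL(2) by simp
  moreover have "(THE x. x \<in> carrier_vec n \<and> inv\<^bsub>GL n\<^esub> M *\<^sub>v x = v) = M *\<^sub>v v"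
  proof (rule the_equality)
    show "M *\<^sub>v v \<in> carrier_vec n \<and> inv\<^bsub>GL n\<^esub> M *\<^sub>v (M *\<^sub>v v) = v"
      using GL v by (simp flip: assoc_mult_mat_vec[of _ n n _ n])
    fix x assume x: "x \<in> carrier_vec n \<and> inv\<^bsub>GL n\<^esub> M *\<^sub>v x = v"
    then have "M *\<^sub>v v = (M * inv\<^bsub>GL n\<^esub> M) *\<^sub>v x"
      using GL(1,2) by (simp add: assoc_mult_mat_vec[of _ n n _ n])
    then show "x = M *\<^sub>v v" using GL(3) x by simp
  qed
  ultimately show ?thesis by (simp add: coordinates_def)
qed

text \<open>For diagonal \<open>D\<close> the first equation says, column by column, that the
  columns of the inverse are eigenvectors of the conjugate. The second undoes the
  conjugation.\<close>

lemma conjugate_mult_inverse: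
  assumes M: "M \<in> carrier (GL n)" and D: "D \<in> carrier_mat n n"
  shows "(inv\<^bsub>GL n\<^esub> M * D * M) * inv\<^bsub>GL n\<^esub> M = inv\<^bsub>GL n\<^esub> M * D"
    "M * (inv\<^bsub>GL n\<^esub> M * D * M) * inv\<^bsub>GL n\<^esub> M = D"
proof -
  note GL = GL_carrierD[OF M]
  have PD: "inv\<^bsub>GL n\<^esub> M * D \<in> carrier_mat n n" using GL D by simp
  show 1: "(inv\<^bsub>GL n\<^esub> M * D * M) * inv\<^bsub>GL n\<^esub> M = inv\<^bsub>GL n\<^esub> M * D"
    using assoc_mult_mat[OF PD GL(1,2)] GL(3) right_mult_one_mat[OF PD] by simp
  have "M * (inv\<^bsub>GL n\<^esub> M * D * M) * inv\<^bsub>GL n\<^esub> M =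
      M * ((inv\<^bsub>GL n\<^esub> M * D * M) * inv\<^bsub>GL n\<^esub> M)"
    using GL PD by (intro assoc_mult_mat) auto
  also have "\<dots> = D"
    using 1 assoc_mult_mat[OF GL(1,2) D] GL D by simp
  finally show "M * (inv\<^bsub>GL n\<^esub> M * D * M) * inv\<^bsub>GL n\<^esub> M = D" .
qed

text \<open>Each column of the matrix is \<open>M * ?A\<close> applied to a basis vector, that is,
  to a column of \<open>?P\<close>; together they form \<open>M * ?A * ?P\<close>, which collapses
  to \<open>D\<close>.\<close>

lemma matrix_of_conjugate:
  assumes M: "M \<in> carrier (GL n)" and D: "D \<in> carrier_mat n n"
  shows "matrix_of n (cols (inv\<^bsub>GL n\<^esub> M)) ((*\<^sub>v) (inv\<^bsub>GL n\<^esub> M * D * M)) = D"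
proof -
  note GL = GL_carrierD[OF M]
  let ?P = "inv\<^bsub>GL n\<^esub> M" let ?A = "?P * D * M"
  have A: "?A \<in> carrier_mat n n" using GL D by simp
  have col: "coordinates n (cols ?P) (?A *\<^sub>v v) = (M * ?A) *\<^sub>v v" if "v \<in> carrier_vec n" for v
    using that A GL(1) by (simp add: coordinates_cols_inverse[OF M] assoc_mult_mat_vec[of _ n n _ n])
  have "matrix_of n (cols ?P) ((*\<^sub>v) ?A) = mat_of_cols n (map ((*\<^sub>v) (M * ?A)) (cols ?P))"
    unfolding matrix_of_def using GL(2) cols_dim[of ?P] col
    by (auto intro!: arg_cong[where f = "mat_of_cols n"] map_cong simp del: assoc_mult_mat)
  also have "map ((*\<^sub>v) (M * ?A)) (cols ?P) = cols (M * ?A * ?P)"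
  proof (rule nth_equalityI)
    fix k assume "k < length (map ((*\<^sub>v) (M * ?A)) (cols ?P))"
    then have k: "k < n" using GL(2) by simp
    have "M * ?A \<in> carrier_mat n n" using GL(1) A by (rule mult_carrier_mat)
    from col_mult2[OF this GL(2) k]
    show "map ((*\<^sub>v) (M * ?A)) (cols ?P) ! k = cols (M * ?A * ?P) ! k"
      using GL(2) k by simp
  qed (use GL(2) in simp)
  also have "\<dots> = cols D"
    using conjugate_mult_inverse(2)[OF M D] by simp
  also have "mat_of_cols n (cols D) = D"
    using D by (metis carrier_matD(1) mat_of_cols_cols)
  finally show ?thesis .
qed

section \<open>Eigenspaces and bases of subspaces\<close>

lemma eigenspace_submodule:
  assumes A: "A \<in> carrier_mat n n"
  shows "submodule (class_ring :: complex ring) {v \<in> carrier_vec n. A *\<^sub>v v = c \<cdot>\<^sub>v v} (cvec n)"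
proof (rule submodule.intro)
  show "Module.module (class_ring :: complex ring) (cvec n)"
    using vectorspace_cvec[of n] by (simp add: vectorspace_def)
qed (use A in \<open>auto simp: module_vec_simps mult_add_distrib_mat_vec mult_mat_vec
      smult_add_distrib_vec smult_smult_assoc mult.commute\<close>)

text \<open>An eigenspace is a subspace, so once it contains a basis of \<open>W\<close> it contains
  the span of that basis.\<close>

lemma eigenspace_of_basis:
  assumes A: "A \<in> carrier_mat n n" and W: "subspc (cvec n) W" and B: "ordered_basis n W vs"
    and eig: "\<And>v. v \<in> set vs \<Longrightarrow> A *\<^sub>v v = c \<cdot>\<^sub>v v"
    and w: "w \<in> W"
  shows "A *\<^sub>v w = c \<cdot>\<^sub>v w"
proof -
  interpret V: vectorspace "class_ring :: complex ring" "cvec n" by (rule vectorspace_cvec)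
  interpret W: vectorspace "class_ring :: complex ring" "cvec n\<lparr>carrier := W\<rparr>"
    using W by (rule V.subspace_is_vs)
  have sub: "submodule class_ring W (cvec n)" using W by (rule V.is_module)
  have vs: "set vs \<subseteq> W" and span: "W.span (set vs) = W"
    using B by (auto simp: ordered_basis_def W.basis_def)
  have "W \<subseteq> carrier_vec n"
    using submodule.subset[OF sub] by (simp add: module_vec_simps)
  then have "V.span (set vs) \<subseteq> {v \<in> carrier_vec n. A *\<^sub>v v = c \<cdot>\<^sub>v v}"
    using vs eig by (intro V.span_is_subset eigenspace_submodule[OF A]) auto
  \<comment> \<open>The basis spans \<open>W\<close> within \<open>W\<close>, while the inclusion
    concerns the span in the whole space; the two spans agree because \<open>W\<close> is a
    submodule.\<close>
  then show ?thesis
    using w span V.span_li_not_depend(1)[OF vs sub] by auto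
qed

text \<open>Links the block sizes of \<open>symmetry_adapted\<close>, which are list lengths, to the
  dimensions of the summands. Distinctness makes the length equal to the cardinality of the
  basis.\<close>

lemma length_ordered_basis:
  assumes W: "subspc (cvec n) W" and B: "ordered_basis n W vs"
  shows "length vs = subspace_dim n W"
proof -
  interpret V: vectorspace "class_ring :: complex ring" "cvec n" by (rule vectorspace_cvec)
  interpret W: vectorspace "class_ring :: complex ring" "cvec n\<lparr>carrier := W\<rparr>"
    using W by (rule V.subspace_is_vs)
  show ?thesis
    using B W.dim_basis[of "set vs"] distinct_card[of vs]
    by (simp add: ordered_basis_def subspace_dim_def)
qed

text \<open>Supplies the eigenvalue belonging to each column of the inverse of
  \<open>M\<close>.\<close>

lemma col_mult_diag:
  assumes P: "P \<in> carrier_mat n n" and v: "v \<in> carrier_vec n" and k: "k < n"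
  shows "col (P * diag v) k = v $ k \<cdot>\<^sub>v col P k"
  using assms by (intro eq_vecI)
    (auto simp: diag_def mat_diag_mult_right mult.commute)

section \<open>Equivariant multiplication maps\<close>

theorem theorem4p5:
  fixes G :: "('g, 'b) monoid_scheme"
    and \<rho> :: "'g \<Rightarrow> complex mat"
    and n3 m :: nat
    and V :: "nat \<Rightarrow> complex vec set"
    and d :: "nat \<Rightarrow> nat"
    and b :: "nat \<Rightarrow> complex vec list"
    and M :: "complex mat"
  assumes "group G" and "finite (carrier G)"
    and "is_representation G n3 \<rho>"
    and "irreducible_decomposition G n3 \<rho> m V"
    and "\<And>j. j < m \<Longrightarrow> subspace_dim n3 (V j) = d j"
    and "symmetry_adapted G n3 \<rho> m V b"
    and "change_of_basis n3 M (concat (map b [0..<m]))"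
  shows "\<exists>W. subspc (tube_ring n3 M) W \<and>
           (\<forall>a\<in>carrier (tube_ring n3 M).
              tube_equivariant G n3 \<rho> (mult_map n3 M a) \<longleftrightarrow> a \<in> W) \<and>
           W = {x \<in> tubes n3. \<exists>c :: nat \<Rightarrow> complex.
                  diag (M *\<^sub>v vec_of_tube n3 x) =
                  diag_block_mat (map (\<lambda>j. c j \<cdot>\<^sub>m 1\<^sub>m (d j)) [0..<m])}"
proof -
  let ?vs = "concat (map b [0..<m])" and ?P = "inv\<^bsub>GL n3\<^esub> M"
  \<comment> \<open>\<open>?u x\<close> holds the coordinates of \<open>x\<close> in the adapted
    basis; its entries are the eigenvalues of multiplication by \<open>x\<close>.\<close>
  let ?u = "\<lambda>x. M *\<^sub>v vec_of_tube n3 x"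
  let ?off = "\<lambda>i. \<Sum>k<i. d k"
  let ?W = "{x \<in> tubes n3. \<exists>c :: nat \<Rightarrow> complex. diag (?u x) =
    diag_block_mat (map (\<lambda>j. c j \<cdot>\<^sub>m 1\<^sub>m (d j)) [0..<m])}"
  have M: "M \<in> carrier (GL n3)" and vs: "cols ?P = ?vs"
    using assms(7) by (auto simp: change_of_basis_def)
  note GL = GL_carrierD[OF M]
  have u: "?u x \<in> carrier_vec n3" for x
    using GL(1) vec_of_tube_carrier by (rule mult_mat_vec_carrier)
  have Vsub: "subspc (cvec n3) (V i)" and
    Vinv: "\<And>g w. g \<in> carrier G \<Longrightarrow> w \<in> V i \<Longrightarrow> \<rho> g *\<^sub>v w \<in> V i" if "i < m" for i
    using assms(4) that
    by (auto simp: irreducible_decomposition_def irreducible_subrep_def subrep_def)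
  have basis: "ordered_basis n3 (V i) (b i)" if "i < m" for i
    using assms(6) that by (simp add: symmetry_adapted_def Let_def)
  have len: "length (b i) = d i" if "i < m" for i
    using length_ordered_basis[OF Vsub[OF that] basis[OF that]] assms(5)[OF that] by simp
  \<comment> \<open>The case \<open>i = m\<close> is included because it gives the total dimension
    \<open>n3\<close>.\<close>
  have off: "(\<Sum>k<i. length (b k)) = ?off i" if "i \<le> m" for i
    using that len by (intro sum.cong) auto
  have "length ?vs = (\<Sum>k<m. length (b k))"
    by (induction m) auto
  then have n3: "n3 = ?off m"
    using off[of m] GL(2) vs by (metis cols_length carrier_matD(2) order_refl)
  have col_P: "col ?P (?off i + r) = b i ! r" if "i < m" "r < d i" for i r
  proof -
    have "?off i + r < n3" using block_index_less[of i m r d] that n3 by simp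
    then have "col ?P (?off i + r) = ?vs ! (?off i + r)"
      using GL(2) by (simp flip: vs)
    then show ?thesis
      using nth_concat_map_upt[of i m r b] that len[of i] off[of i] by simp
  qed
  have W_iff: "x \<in> ?W \<longleftrightarrow> x \<in> tubes n3 \<and>
      (\<exists>c. \<forall>i<m. \<forall>r<d i. ?u x $ (?off i + r) = c i)" for x
    using diag_eq_scalar_blocks_iff[of "?u x" d m, OF trans[OF carrier_vecD[OF u] n3]] by simp

  \<comment> \<open>Equivariance and constancy on blocks\<close>
  have equiv_iff: "tube_equivariant G n3 \<rho> (mult_map n3 M a) \<longleftrightarrow> a \<in> ?W"
    if a: "a \<in> tubes n3" for a
  proof -
    let ?D = "diag (?u a)" let ?A = "?P * ?D * M"
    have D: "?D \<in> carrier_mat n3 n3" using u by (rule diag_carrier)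
    have A: "?A \<in> carrier_mat n3 n3" using GL D by simp
    have "equivariant_linear G n3 \<rho> ((*\<^sub>v) ?A) \<longleftrightarrow>
      (\<exists>c. \<forall>i<m. \<forall>r<d i. ?u a $ (?off i + r) = c i)"
    proof
      assume "equivariant_linear G n3 \<rho> ((*\<^sub>v) ?A)"
      \<comment> \<open>By \<open>matrix_of_conjugate\<close> the matrix in the adapted basis is
        \<open>?D\<close>; adaptedness is applied to its blocks with \<open>j = i\<close>, whose
        diagonals carry the entries of \<open>?u a\<close>.\<close>
      then have block: "(\<exists>c. matrix_block (\<lambda>i. length (b i)) ?D i i = c \<cdot>\<^sub>m 1\<^sub>m (length (b i))) \<or>
          matrix_block (\<lambda>i. length (b i)) ?D i i = 0\<^sub>m (length (b i)) (length (b i))"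
        if "i < m" for i
        using assms(6) that matrix_of_conjugate[OF M D] unfolding vs symmetry_adapted_def Let_def
        by metis
      have "\<exists>c. \<forall>r<d i. ?u a $ (?off i + r) = c" if i: "i < m" for i
      proof -
        have entry: "matrix_block (\<lambda>i. length (b i)) ?D i i $$ (r, r) = ?u a $ (?off i + r)"
          if r: "r < d i" for r
        proof -
          have "?off i + r < dim_vec (?u a)"
            using block_index_less[of i m r d] i r n3 carrier_vecD[OF u[of a]] by simp
          then show ?thesis
            using i r off[of i] by (simp add: matrix_block_def len diag_def mat_diag_def)
        qed
        show ?thesis using block[OF i]
        proof
          assume "\<exists>c. matrix_block (\<lambda>i. length (b i)) ?D i i = c \<cdot>\<^sub>m 1\<^sub>m (length (b i))"
          then show ?thesis using entry len[OF i] by fastforce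
        next
          \<comment> \<open>A zero block is the scalar case with constant \<open>0\<close>.\<close>
          assume "matrix_block (\<lambda>i. length (b i)) ?D i i = 0\<^sub>m (length (b i)) (length (b i))"
          then show ?thesis using entry len[OF i] by fastforce
        qed
      qed
      then show "\<exists>c. \<forall>i<m. \<forall>r<d i. ?u a $ (?off i + r) = c i" by metis
    next
      assume "\<exists>c. \<forall>i<m. \<forall>r<d i. ?u a $ (?off i + r) = c i"
      then obtain c where c: "\<And>i r. i < m \<Longrightarrow> r < d i \<Longrightarrow> ?u a $ (?off i + r) = c i" by blast
      \<comment> \<open>The basis vectors of one block share the eigenvalue \<open>c i\<close>,
        hence so do all vectors of the summand.\<close>
      have eig: "?A *\<^sub>v w = c i \<cdot>\<^sub>v w" if i: "i < m" and w: "w \<in> V i" for i w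
      proof (rule eigenspace_of_basis[OF A Vsub[OF i] basis[OF i] _ w])
        fix v assume "v \<in> set (b i)"
        then obtain r where r: "r < d i" "v = b i ! r"
          using len[OF i] by (metis in_set_conv_nth)
        let ?k = "?off i + r"
        have k: "?k < n3" using block_index_less[of i m r d] i r n3 by simp
        have "?A *\<^sub>v col ?P ?k = col (?A * ?P) ?k"
          by (rule col_mult2[OF A GL(2) k, symmetric])
        also have "\<dots> = c i \<cdot>\<^sub>v col ?P ?k"
          using col_mult_diag[OF GL(2) u k, of a] c[OF i r(1)] conjugate_mult_inverse(1)[OF M D]
          by simp
        finally show "?A *\<^sub>v v = c i \<cdot>\<^sub>v v" using col_P i r by simp
      qed
      have "?A *\<^sub>v (\<rho> g *\<^sub>v v) = \<rho> g *\<^sub>v (?A *\<^sub>v v)"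
        if g: "g \<in> carrier G" and v: "v \<in> carrier_vec n3" for g v
      proof -
        have rho: "\<rho> g \<in> carrier_mat n3 n3"
          using assms(3) g GL_carrierD(1) unfolding is_representation_def
          by (metis hom_in_carrier)
        \<comment> \<open>Comparing columns after multiplication by \<open>?P\<close> amounts to
          checking commutation on the adapted basis vectors alone.\<close>
        have "(?A * \<rho> g) * ?P = (\<rho> g * ?A) * ?P"
        proof (rule mat_col_eqI)
          fix k assume "k < dim_col (\<rho> g * ?A * ?P)"
          then have k: "k < n3" using GL(2) by simp
          then obtain i r where i: "i < m" and r: "r < d i" and k_eq: "k = ?off i + r"
            unfolding n3 by (rule block_index_cases)
          have carr: "col ?P k \<in> carrier_vec n3" using GL(2) by (simp add: carrier_vecI)
          have "set (b i) \<subseteq> V i"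
            using basis[OF i] vectorspace.basis_def[OF
                vectorspace.subspace_is_vs[OF vectorspace_cvec Vsub[OF i]]]
            by (simp add: ordered_basis_def)
          then have in_V: "col ?P k \<in> V i"
            unfolding k_eq col_P[OF i r] using r len[OF i] by (metis nth_mem subsetD)
          have "col ((?A * \<rho> g) * ?P) k = ?A *\<^sub>v (\<rho> g *\<^sub>v col ?P k)"
            using col_mult2[OF mult_carrier_mat[OF A rho] GL(2) k] assoc_mult_mat_vec[OF A rho carr]
            by simp
          \<comment> \<open>Invariance enters here: the image under \<open>\<rho> g\<close> stays in
            \<open>V i\<close>, so \<open>?A\<close> scales it by the same
            \<open>c i\<close>.\<close>
          also have "\<dots> = c i \<cdot>\<^sub>v (\<rho> g *\<^sub>v col ?P k)"
            using eig[OF i Vinv[OF i g in_V]] .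
          also have "\<dots> = \<rho> g *\<^sub>v (?A *\<^sub>v col ?P k)"
            using eig[OF i in_V] mult_mat_vec[OF rho carr] by simp
          also have "\<dots> = col ((\<rho> g * ?A) * ?P) k"
            using col_mult2[OF mult_carrier_mat[OF rho A] GL(2) k] assoc_mult_mat_vec[OF rho A carr]
            by simp
          finally show "col ((?A * \<rho> g) * ?P) k = col ((\<rho> g * ?A) * ?P) k" .
        qed (use A rho GL(2) in auto)
        \<comment> \<open>Multiplying by \<open>M\<close> on the right cancels
          \<open>?P\<close>.\<close>
        then have "(?A * \<rho> g) * ?P * M = (\<rho> g * ?A) * ?P * M" by simp
        moreover have "X * ?P * M = X" if "X \<in> carrier_mat n3 n3" for X
          using assoc_mult_mat[OF that GL(2,1)] GL(4) that by simp
        ultimately have "?A * \<rho> g = \<rho> g * ?A"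
          using mult_carrier_mat[OF A rho] mult_carrier_mat[OF rho A] by simp
        then show ?thesis
          using assoc_mult_mat_vec[OF A rho v] assoc_mult_mat_vec[OF rho A v] by simp
      qed
      then show "equivariant_linear G n3 \<rho> ((*\<^sub>v) ?A)"
        using equivariant_linear_mat_iff[OF A] by blast
    qed
    then show ?thesis
      unfolding tube_equivariant_mult_map_iff[OF M assms(3)] W_iff using a by simp
  qed

  \<comment> \<open>Linearity of the block condition\<close>
  have idx: "?off i + r < n3" if "i < m" "r < d i" for i r
    using block_index_less[of i m r d] that n3 by simp
  \<comment> \<open>Since \<open>?u\<close> is linear, the block constants follow the vector
    operations: the witnesses below are \<open>0\<close>, \<open>c i + e i\<close> and
    \<open>s * c i\<close>.\<close>
  have u_zero: "?u (\<lambda>i j k. 0) = 0\<^sub>v n3"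
  proof -
    have "vec_of_tube n3 (\<lambda>i j k. 0) = 0\<^sub>v n3" by (auto simp: vec_of_tube_def)
    then show ?thesis using GL(1) by (auto intro!: eq_vecI simp: scalar_prod_def)
  qed
  have u_add: "?u (\<lambda>i j k. x i j k + y i j k) = ?u x + ?u y" for x y
  proof -
    have "vec_of_tube n3 (\<lambda>i j k. x i j k + y i j k) = vec_of_tube n3 x + vec_of_tube n3 y"
      by (auto simp: vec_of_tube_def)
    then show ?thesis
      using mult_add_distrib_mat_vec[OF GL(1) vec_of_tube_carrier vec_of_tube_carrier] by simp
  qed
  have u_smult: "?u (\<lambda>i j k. s * x i j k) = s \<cdot>\<^sub>v ?u x" for s x
  proof -
    have "vec_of_tube n3 (\<lambda>i j k. s * x i j k) = s \<cdot>\<^sub>v vec_of_tube n3 x"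
      by (auto simp: vec_of_tube_def)
    then show ?thesis using mult_mat_vec[OF GL(1) vec_of_tube_carrier] by simp
  qed
  have subspace: "subspc (tube_ring n3 M) ?W"
  proof (rule VectorSpace.subspace.intro[OF vectorspace_tube_ring], rule submodule.intro)
    show "Module.module (class_ring :: complex ring) (tube_ring n3 M)"
      using vectorspace_tube_ring by (simp add: vectorspace_def)
    show "?W \<subseteq> carrier (tube_ring n3 M)" by (auto simp: tube_ring_def)
    show "\<zero>\<^bsub>tube_ring n3 M\<^esub> \<in> ?W"
    proof -
      have "\<forall>i<m. \<forall>r<d i. ?u (\<lambda>i j k. 0) $ (?off i + r) = 0"
        unfolding u_zero using idx by (metis index_zero_vec(1))
      then have "\<exists>c. \<forall>i<m. \<forall>r<d i. ?u (\<lambda>i j k. 0) $ (?off i + r) = c i"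
        by (rule exI[of _ "\<lambda>_. 0"])
      then show ?thesis unfolding W_iff by (simp add: tube_ring_def tubes_def)
    qed
  next
    fix x y assume "x \<in> ?W" "y \<in> ?W"
    then obtain c e where tubes: "x \<in> tubes n3" "y \<in> tubes n3" and
      "\<forall>i<m. \<forall>r<d i. ?u x $ (?off i + r) = c i" "\<forall>i<m. \<forall>r<d i. ?u y $ (?off i + r) = e i"
      unfolding W_iff by blast
    then have "\<forall>i<m. \<forall>r<d i. (?u x + ?u y) $ (?off i + r) = c i + e i"
      using idx carrier_vecD[OF u[of y]] by (metis index_add_vec(1))
    then have "\<exists>c. \<forall>i<m. \<forall>r<d i. ?u (\<lambda>i j k. x i j k + y i j k) $ (?off i + r) = c i"
      unfolding u_add by (rule exI[of _ "\<lambda>i. c i + e i"])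
    then show "x \<oplus>\<^bsub>tube_ring n3 M\<^esub> y \<in> ?W"
      unfolding W_iff using tubes by (simp add: tube_ring_def tubes_def)
  next
    fix s x assume "x \<in> ?W"
    then obtain c where tubes: "x \<in> tubes n3" and
      "\<forall>i<m. \<forall>r<d i. ?u x $ (?off i + r) = c i"
      unfolding W_iff by blast
    then have "\<forall>i<m. \<forall>r<d i. (s \<cdot>\<^sub>v ?u x) $ (?off i + r) = s * c i"
      using idx carrier_vecD[OF u[of x]] by (metis index_smult_vec(1))
    then have "\<exists>c. \<forall>i<m. \<forall>r<d i. ?u (\<lambda>i j k. s * x i j k) $ (?off i + r) = c i"
      unfolding u_smult by (rule exI[of _ "\<lambda>i. s * c i"])
    then show "s \<odot>\<^bsub>tube_ring n3 M\<^esub> x \<in> ?W"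
      unfolding W_iff using tubes by (simp add: tube_ring_def tubes_def)
  qed
  show ?thesis
  proof (intro exI conjI ballI)
    fix a assume "a \<in> carrier (tube_ring n3 M)"
    then show "tube_equivariant G n3 \<rho> (mult_map n3 M a) \<longleftrightarrow> a \<in> ?W"
      by (intro equiv_iff) (simp add: tube_ring_def)
  qed (rule subspace refl)+
qed

end
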